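(* Let $\mathcal{X}\subseteq\mathbb{R}^n$ and $\mathcal{U}=\prod_{k=1}^m[\underline{u}_k,\overline{u}_k]\subseteq\mathbb{R}^m$ be boxes, let $\mathbb{S}=\{[\bm b_1],\dots,[\bm b_N]\}$ be a subpaving of $\mathcal{X}$, and let $[\bm b]\in\mathbb{S}$. Let $[f]_{[\bm b]}(u)=\prod_{j=1}^n[\underline{a}_j^\top u+\underline{c}_j,\ \overline{a}_j^\top u+\overline{c}_j]$ be a control-affine enclosure of $f$ over $[\bm b]$ and $\mathcal{U}$, and assume that $[f]_{[\bm b]}(u)$ is a non-degenerate box for every $u\in\mathcal{U}$. Let $\mathcal{A}([\bm b])$ be the associated hyperplane arrangement in $\mathbb{R}^m$, let $\mathcal{F}$ be the set of all faces of $\mathcal{A}([\bm b])$ contained in $\mathcal{U}$, and let $\mathcal{R}\subset\mathcal{F}$ be the set of regions (full-dimensional faces) in $\mathcal{F}$. Define the covering indicator $\varphi(u)=1$ if $[f]_{[\bm b]}(u)\subseteq\mathbb{S}$ (where $\mathbb{S}$ is viewed as the union of its boxes) and $\varphi(u)=0$ otherwise. Then the following two statements hold: (i) For each face $F\in\mathcal{F}$, $\varphi(u)$ is invariant for any $u\in F$ (that is, $\varphi$ is constant on $F$). (ii) If $\varphi(u)=1$ on a region $R_i\in\mathcal{R}$, then $\varphi(u)=1$ on every face contained in the closure $\overline{R}_i$.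
   Context: A box in $\mathbb{R}^n$ is a Cartesian product of $n$ closed intervals $[\underline{x},\overline{x}]$ with $\underline{x}\le\overline{x}$; it is non-degenerate if it has nonempty interior. A subpaving of a box $\mathcal{X}$ is a finite set of boxes contained in $\mathcal{X}$ with pairwise disjoint interiors; depending on the context it is also viewed as the union of its boxes. System: $x_{k+1}=f(x_k,u_k)$ with $f=f_0+f_{\mathrm{NN}}:\mathbb{R}^n\times\mathbb{R}^m\to\mathbb{R}^n$, $x_k\in\mathcal{X}$, $u_k\in\mathcal{U}$. Here $f_0$ is twice continuously differentiable on an open set containing $\mathcal{X}\times\mathcal{U}$ with bounded second-order partial derivatives, and $f_{\mathrm{NN}}$ is a feed-forward neural network: $z^{(0)}=(x,u)$, $z^{(i)}=\sigma(W^{(i)}z^{(i-1)}+b^{(i)})$ for $i=1,\dots,\ell-1$, $f_{\mathrm{NN}}(x,u)=W^{(\ell)}z^{(\ell-1)}+b^{(\ell)}$, with weight matrices $W^{(i)}$, bias vectors $b^{(i)}$, and $\sigma$ an activation function (such as ReLU or $\tanh$) applied elementwise. Control-affine enclosure of $f$ over $[\bm b]$ and $\mathcal{U}$: the box-valued map $[f]_{[\bm b]}(u)=\prod_{j=1}^n[\underline{a}_j^\top u+\underline{c}_j,\ \overline{a}_j^\top u+\overline{c}_j]$, with coefficients $\underline{a}_j,\overline{a}_j\in\mathbb{R}^m$ and $\underline{c}_j,\overline{c}_j\in\mathbb{R}$ determined by $[\bm b]$ and $\mathcal{U}$ (independent of $u$), such that $f(x,u)\in[f]_{[\bm b]}(u)$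 for all $x\in[\bm b]$ and $u\in\mathcal{U}$. Grid coordinates: for each $j\in\{1,\dots,n\}$, $G_j=\{g_j^{(1)}<\dots<g_j^{(N_j)}\}$ is the sorted set of all $j$-th coordinates of vertices of boxes in $\mathbb{S}$. Hyperplane arrangements: an affine hyperplane in $\mathbb{R}^m$ is a set $\{v\in\mathbb{R}^m:\alpha^\top v=\beta\}$ with $\alpha\in\mathbb{R}^m$ a nonzero vector and $\beta\in\mathbb{R}$. A hyperplane arrangement is a finite set of affine hyperplanes. The sign pattern of a point $v$ with respect to an arrangement of hyperplanes $\{v:\alpha_i^\top v=\beta_i\}$, $i=1,\dots,M$, is $(\operatorname{sgn}(\alpha_1^\top v-\beta_1),\dots,\operatorname{sgn}(\alpha_M^\top v-\beta_M))\in\{-1,0,+1\}^M$. A face of the arrangement is a maximal connected set of points sharing the same sign pattern. A region is a full-dimensional face. Arrangement $\mathcal{A}([\bm b])$: the hyperplane arrangement in $\mathbb{R}^m$ consisting of the affine hyperplanes $\underline{\mathcal{H}}_{j,q}=\{u\in\mathbb{R}^m:\underline{a}_j^\top u+\underline{c}_j=g_j^{(q)}\}$ and $\overline{\mathcal{H}}_{j,q}=\{u\in\mathbb{R}^m:\overline{a}_j^\top u+\overline{c}_j=g_j^{(q)}\}$ for $1\le j\le n$, $1\le q\le N_j$, together with the $2m$ boundary hyperplanes $\{u\in\mathbb{R}^m:u_k=\underline{u}_k\}$ and $\{u\in\mathbb{R}^m:u_k=\overline{u}_k\}$ for $1\le k\le m$. *)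

theory Defs
  imports "HOL-Analysis.Analysis"
begin

subsection \<open>Boxes and subpavings\<close>

definition is_box :: "(real ^ 'n) set \<Rightarrow> bool" where
  "is_box B \<longleftrightarrow> (\<exists>l h. l \<le> h \<and> B = cbox l h)"

definition nondegenerate_box :: "(real ^ 'n) set \<Rightarrow> bool" where
  "nondegenerate_box B \<longleftrightarrow> is_box B \<and> interior B \<noteq> {}"

definition subpaving :: "(real ^ 'n) set \<Rightarrow> (real ^ 'n) set set \<Rightarrow> bool" where
  "subpaving X S \<longleftrightarrow>
     finite S \<and> (\<forall>B\<in>S. is_box B \<and> B \<subseteq> X) \<and>
     pairwise (\<lambda>B C. interior B \<inter> interior C = {}) S"

definition box_vertices :: "(real ^ 'n) set \<Rightarrow> (real ^ 'n) set" where
  "box_vertices B = {v. \<exists>l h. l \<le> h \<and> B = cbox l h \<and> (\<forall>j. v $ j = l $ j \<or> v $ j = h $ j)}"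

definition grid_coords :: "(real ^ 'n) set set \<Rightarrow> 'n \<Rightarrow> real set" where
  "grid_coords S j = (\<Union>B\<in>S. (\<lambda>v. v $ j) ` box_vertices B)"

subsection \<open>The dynamics\<close>

text \<open>
  Second-order partial derivatives are the entries
  \<open>f'' p i j \<bullet> k\<close> of the second Frechet derivative, for basis vectors \<open>i j k\<close>.
\<close>

definition C2_bounded_partials_on ::
  "('a::euclidean_space \<Rightarrow> 'b::euclidean_space) \<Rightarrow> 'a set \<Rightarrow> bool" where
  "C2_bounded_partials_on f D \<longleftrightarrow>
     (\<exists>(f' :: 'a \<Rightarrow> 'a \<Rightarrow>\<^sub>L 'b) (f'' :: 'a \<Rightarrow> 'a \<Rightarrow>\<^sub>L ('a \<Rightarrow>\<^sub>L 'b)).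
        (\<forall>p\<in>D. (f has_derivative blinfun_apply (f' p)) (at p)) \<and>
        (\<forall>p\<in>D. (f' has_derivative blinfun_apply (f'' p)) (at p)) \<and>
        continuous_on D f'' \<and>
        (\<forall>i\<in>Basis. \<forall>j\<in>Basis. \<forall>k\<in>Basis.
           bounded ((\<lambda>p. blinfun_apply (blinfun_apply (f'' p) i) j \<bullet> k) ` D)))"

text \<open>
  Hidden layers have arbitrary widths, so layer vectors are functions on \<open>nat\<close>:
  layer \<open>i\<close> uses the indices below \<open>d i\<close>, and \<open>W i r s\<close> (\<open>r < d i\<close>, \<open>s < d (i - 1)\<close>) and
  \<open>c i r\<close> are the entries of its weight matrix and bias vector.  The input stacks the
  coordinates of \<open>x\<close> and then of \<open>u\<close>, in the fixed enumeration of the finite index types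
  given by \<open>from_nat_into UNIV\<close> (with inverse \<open>to_nat_on UNIV\<close>).
\<close>

definition nn_input :: "real ^ 'n \<Rightarrow> real ^ 'm \<Rightarrow> nat \<Rightarrow> real" where
  "nn_input x u s =
     (if s < CARD('n) then x $ from_nat_into UNIV s
      else u $ from_nat_into UNIV (s - CARD('n)))"

definition nn_preact ::
  "(nat \<Rightarrow> nat) \<Rightarrow> (nat \<Rightarrow> nat \<Rightarrow> nat \<Rightarrow> real) \<Rightarrow> (nat \<Rightarrow> nat \<Rightarrow> real) \<Rightarrow>
   nat \<Rightarrow> (nat \<Rightarrow> real) \<Rightarrow> nat \<Rightarrow> real" where
  "nn_preact d W c i z r = (\<Sum>s<d (i - 1). W i r s * z s) + c i r"

fun nn_layer ::
  "(real \<Rightarrow> real) \<Rightarrow> (nat \<Rightarrow> nat) \<Rightarrow> (nat \<Rightarrow> nat \<Rightarrow> nat \<Rightarrow> real) \<Rightarrow> (nat \<Rightarrow> nat \<Rightarrow> real) \<Rightarrow>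
   (nat \<Rightarrow> real) \<Rightarrow> nat \<Rightarrow> nat \<Rightarrow> real" where
  "nn_layer \<sigma> d W c z0 0 = z0"
| "nn_layer \<sigma> d W c z0 (Suc i) = (\<lambda>r. \<sigma> (nn_preact d W c (Suc i) (nn_layer \<sigma> d W c z0 i) r))"

definition feed_forward_network ::
  "(real \<Rightarrow> real) \<Rightarrow> (real ^ 'n \<Rightarrow> real ^ 'm \<Rightarrow> real ^ 'n) \<Rightarrow> bool" where
  "feed_forward_network \<sigma> g \<longleftrightarrow>
     (\<exists>L d W c. L \<ge> 1 \<and> d 0 = CARD('n) + CARD('m) \<and> d L = CARD('n) \<and>
        (\<forall>x u. g x u =
           (\<chi> j. nn_preact d W c L (nn_layer \<sigma> d W c (nn_input x u) (L - 1))
                   (to_nat_on UNIV j))))"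

subsection \<open>Control-affine enclosures\<close>

definition affine_box ::
  "('n \<Rightarrow> real ^ 'm) \<Rightarrow> ('n \<Rightarrow> real) \<Rightarrow> ('n \<Rightarrow> real ^ 'm) \<Rightarrow> ('n \<Rightarrow> real) \<Rightarrow>
   real ^ 'm \<Rightarrow> (real ^ 'n) set" where
  "affine_box a_lo c_lo a_hi c_hi u =
     cbox (\<chi> j. a_lo j \<bullet> u + c_lo j) (\<chi> j. a_hi j \<bullet> u + c_hi j)"

definition control_affine_enclosure ::
  "(real ^ 'n \<Rightarrow> real ^ 'm \<Rightarrow> real ^ 'n) \<Rightarrow> (real ^ 'n) set \<Rightarrow> (real ^ 'm) set \<Rightarrow>
   ('n \<Rightarrow> real ^ 'm) \<Rightarrow> ('n \<Rightarrow> real) \<Rightarrow> ('n \<Rightarrow> real ^ 'm) \<Rightarrow> ('n \<Rightarrow> real) \<Rightarrow> bool" where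
  "control_affine_enclosure f B U a_lo c_lo a_hi c_hi \<longleftrightarrow>
     (\<forall>x\<in>B. \<forall>u\<in>U. f x u \<in> affine_box a_lo c_lo a_hi c_hi u)"

definition covering_indicator ::
  "(real ^ 'm \<Rightarrow> (real ^ 'n) set) \<Rightarrow> (real ^ 'n) set set \<Rightarrow> real ^ 'm \<Rightarrow> nat" where
  "covering_indicator F S u = (if F u \<subseteq> \<Union>S then 1 else 0)"

subsection \<open>Hyperplane arrangements\<close>

text \<open>
  The pair \<open>(\<alpha>, \<beta>)\<close> stands for the affine hyperplane \<open>{v. \<alpha> \<bullet> v = \<beta>}\<close>; sign patterns depend on
  the chosen equations, but the partition into faces does not.
\<close>

definition hyperplane_arrangement :: "('a::euclidean_space \<times> real) set \<Rightarrow> bool" where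
  "hyperplane_arrangement A \<longleftrightarrow> finite A \<and> (\<forall>(\<alpha>, \<beta>)\<in>A. \<alpha> \<noteq> 0)"

definition sign_pattern ::
  "('a::euclidean_space \<times> real) set \<Rightarrow> 'a \<Rightarrow> ('a \<times> real) \<Rightarrow> real" where
  "sign_pattern A v = (\<lambda>h\<in>A. sgn (fst h \<bullet> v - snd h))"

definition connected_same_sign :: "('a::euclidean_space \<times> real) set \<Rightarrow> 'a set \<Rightarrow> bool" where
  "connected_same_sign A F \<longleftrightarrow>
     connected F \<and> (\<forall>v\<in>F. \<forall>w\<in>F. sign_pattern A v = sign_pattern A w)"

definition arrangement_face :: "('a::euclidean_space \<times> real) set \<Rightarrow> 'a set \<Rightarrow> bool" where
  "arrangement_face A F \<longleftrightarrow>
     connected_same_sign A F \<and> (\<forall>G. connected_same_sign A G \<and> F \<subseteq> G \<longrightarrow> G = F)"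

definition arrangement_region :: "('a::euclidean_space \<times> real) set \<Rightarrow> 'a set \<Rightarrow> bool" where
  "arrangement_region A R \<longleftrightarrow> arrangement_face A R \<and> aff_dim R = int DIM('a)"

text \<open>
  A grid equation with zero normal vector does not describe an affine hyperplane and
  contributes nothing to the arrangement.
\<close>

definition enclosure_arrangement ::
  "('n \<Rightarrow> real ^ 'm) \<Rightarrow> ('n \<Rightarrow> real) \<Rightarrow> ('n \<Rightarrow> real ^ 'm) \<Rightarrow> ('n \<Rightarrow> real) \<Rightarrow>
   (real ^ 'n) set set \<Rightarrow> real ^ 'm \<Rightarrow> real ^ 'm \<Rightarrow> ((real ^ 'm) \<times> real) set" where
  "enclosure_arrangement a_lo c_lo a_hi c_hi S u_lo u_hi =
     {(a_lo j, g - c_lo j) | j g. g \<in> grid_coords S j \<and> a_lo j \<noteq> 0} \<union>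
     {(a_hi j, g - c_hi j) | j g. g \<in> grid_coords S j \<and> a_hi j \<noteq> 0} \<union>
     {(axis k 1, u_lo $ k) | k. True} \<union>
     {(axis k 1, u_hi $ k) | k. True}"

lemma finite_grid_coords:
  fixes S :: "(real ^ 'n) set set"
  assumes "finite S"
  shows "finite (grid_coords S j)"
proof -
  have "finite ((\<lambda>v. v $ j) ` box_vertices B)" for B :: "(real ^ 'n) set"
  proof (cases "\<exists>l h. l \<le> h \<and> B = cbox l h")
    case True
    then obtain l h where lh: "l \<le> h" "B = cbox l h" by blast
    have "(\<lambda>v. v $ j) ` box_vertices B \<subseteq> {l $ j, h $ j}"
    proof
      fix t assume "t \<in> (\<lambda>v. v $ j) ` box_vertices B"
      then obtain v l' h' where v: "t = v $ j" "l' \<le> h'" "B = cbox l' h'"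
          "v $ j = l' $ j \<or> v $ j = h' $ j"
        unfolding box_vertices_def by blast
      have "cbox l h = {l..h}" "cbox l' h' = {l'..h'}" by (simp_all add: interval_cbox)
      then have "l = l' \<and> h = h'" using lh v by (metis Icc_eq_Icc)
      then show "t \<in> {l $ j, h $ j}" using v by auto
    qed
    then show ?thesis using finite_subset by blast
  next
    case False
    then have "box_vertices B = {}" unfolding box_vertices_def by blast
    then show ?thesis by simp
  qed
  then show ?thesis using assms unfolding grid_coords_def by blast
qed

lemma hyperplane_arrangement_enclosure_arrangement:
  fixes S :: "(real ^ 'n) set set" and u_lo u_hi :: "real ^ 'm"
  assumes "finite S"
  shows "hyperplane_arrangement (enclosure_arrangement a_lo c_lo a_hi c_hi S u_lo u_hi)"
proof -
  have fin: "finite {(a j, g - c j) | j g. g \<in> grid_coords S j \<and> a j \<noteq> 0}"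
    for a :: "'n \<Rightarrow> real ^ 'm" and c
  proof (rule finite_subset)
    show "{(a j, g - c j) | j g. g \<in> grid_coords S j \<and> a j \<noteq> 0}
       \<subseteq> (\<Union>j. (\<lambda>g. (a j, g - c j)) ` grid_coords S j)" by blast
    show "finite (\<Union>j. (\<lambda>g. (a j, g - c j)) ` grid_coords S j)"
      using finite_grid_coords[OF assms] by simp
  qed
  have axes: "finite {(axis k (1::real), w $ k) | k. True}" for w :: "real ^ 'm"
    by (rule finite_subset[of _ "range (\<lambda>k. (axis k 1, w $ k))"]) auto
  have "finite (enclosure_arrangement a_lo c_lo a_hi c_hi S u_lo u_hi)"
    unfolding enclosure_arrangement_def by (intro finite_UnI fin axes)
  then show ?thesis
    unfolding hyperplane_arrangement_def enclosure_arrangement_def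
    by (auto simp: axis_eq_0_iff)
qed

end

theory Submission
  imports Defs
begin

text \<open>
  Both parts rest on clamping. Clamp a point \<open>y\<close> coordinatewise into a box \<open>[l, h]\<close>: this
  moves \<open>y\<close> to a point of \<open>[l, h]\<close> and fixes the points already there.

  For (i), let \<open>u\<close> and \<open>v\<close> lie in one face, suppose that \<open>enc u\<close> is covered, and let
  \<open>y \<in> enc v\<close>. In every coordinate the endpoints of \<open>enc u\<close> and \<open>enc v\<close> compare in the same
  way with all grid values: for a nonzero normal vector this is what the sign pattern records,
  and for a zero normal vector the endpoint does not depend on the input. Hence clamping \<open>y\<close>
  into \<open>enc u\<close> never moves a coordinate onto, off or across a grid value. The box of the subpaving
  that contains the clamped point is cut out by grid values, so it contains \<open>y\<close> too
  (\<open>covered_if_endpoints_compare_alike\<close>). Thus \<open>enc v\<close> is covered.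

  For (ii), let \<open>v\<close> be in the closure of \<open>R\<close> and \<open>y \<in> enc v\<close>. Clamping \<open>y\<close> into \<open>enc u\<close> depends
  continuously on \<open>u\<close>. For \<open>u \<in> R\<close> the result lies in \<open>\<Union>S\<close>, which is closed as a finite union
  of closed boxes, so the same holds at \<open>u = v\<close>, where the result is \<open>y\<close>
  (\<open>affine_box_subset_closed_on_closure\<close>).
\<close>

section \<open>Clamping into a box\<close>

definition clamp_box :: "real ^ 'n \<Rightarrow> real ^ 'n \<Rightarrow> real ^ 'n \<Rightarrow> real ^ 'n" where
  "clamp_box l h y = (\<chi> j. max (l $ j) (min (h $ j) (y $ j)))"

lemma clamp_box_in_cbox:
  assumes "l \<le> h"
  shows "clamp_box l h y \<in> cbox l h"
  using assms by (auto simp: clamp_box_def mem_box_cart less_eq_vec_def)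

lemma clamp_box_id:
  assumes "y \<in> cbox l h"
  shows "clamp_box l h y = y"
  using assms by (auto simp: clamp_box_def mem_box_cart vec_eq_iff)

lemma continuous_on_clamp_box [continuous_intros]:
  assumes "continuous_on T l" and "continuous_on T h"
  shows "continuous_on T (\<lambda>u. clamp_box (l u) (h u) y)"
  unfolding clamp_box_def by (intro continuous_intros assms)

section \<open>Grid values and subpavings\<close>

lemma sgn_diff_eq_iff:
  fixes a b g :: real
  shows "sgn (a - g) = sgn (b - g) \<longleftrightarrow> (a < g \<longleftrightarrow> b < g) \<and> (g < a \<longleftrightarrow> g < b)"
  by (auto simp: sgn_real_def)

lemma grid_coords_of_box:
  assumes "cbox p q \<in> S" and "p \<le> q"
  shows "p $ j \<in> grid_coords S j" and "q $ j \<in> grid_coords S j"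
proof -
  have "p \<in> box_vertices (cbox p q)" "q \<in> box_vertices (cbox p q)"
    using assms(2) unfolding box_vertices_def by blast+
  then show "p $ j \<in> grid_coords S j" "q $ j \<in> grid_coords S j"
    using assms(1) unfolding grid_coords_def by blast+
qed

lemma closed_Union_subpaving:
  assumes "subpaving X S"
  shows "closed (\<Union>S)"
proof (rule closed_Union)
  show "finite S"
    using assms by (simp add: subpaving_def)
  show "\<forall>C\<in>S. closed C"
    using assms unfolding subpaving_def is_box_def by (metis closed_cbox)
qed

text \<open>
  Suppose that clamping lowers \<open>y $ j\<close> to \<open>h $ j\<close>. A grid value \<open>g\<close> with \<open>h $ j < g \<le> y $ j\<close>
  would satisfy \<open>g \<le> h' $ j\<close> but not \<open>g \<le> h $ j\<close>, and a grid value \<open>g = h $ j < y $ j\<close> would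
  satisfy \<open>g < h' $ j\<close> but not \<open>g < h $ j\<close>, so no grid value lies in \<open>[h $ j, y $ j]\<close>. Raising
  \<open>y $ j\<close> to \<open>l $ j\<close> is symmetric.
\<close>
lemma covered_if_endpoints_compare_alike:
  fixes S :: "(real ^ 'n) set set"
  assumes boxes: "\<forall>C\<in>S. is_box C"
    and covered: "cbox l h \<subseteq> \<Union>S" and "l \<le> h"
    and lo: "\<And>j g. g \<in> grid_coords S j \<Longrightarrow> sgn (l $ j - g) = sgn (l' $ j - g)"
    and hi: "\<And>j g. g \<in> grid_coords S j \<Longrightarrow> sgn (h $ j - g) = sgn (h' $ j - g)"
  shows "cbox l' h' \<subseteq> \<Union>S"
proof
  fix y assume y: "y \<in> cbox l' h'"
  define x where "x = clamp_box l h y"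
  have "x \<in> cbox l h"
    unfolding x_def using \<open>l \<le> h\<close> by (rule clamp_box_in_cbox)
  then obtain C where C: "C \<in> S" "x \<in> C"
    using covered by blast
  then obtain p q where pq: "p \<le> q" "C = cbox p q"
    using boxes unfolding is_box_def by blast
  have same_cell: "sgn (x $ j - g) = sgn (y $ j - g)" if g: "g \<in> grid_coords S j" for j g
  proof -
    have "l $ j \<le> h $ j" "l' $ j \<le> y $ j" "y $ j \<le> h' $ j"
      using \<open>l \<le> h\<close> y by (auto simp: less_eq_vec_def mem_box_cart)
    moreover have "x $ j = max (l $ j) (min (h $ j) (y $ j))"
      by (simp add: x_def clamp_box_def)
    ultimately show ?thesis
      using lo[OF g] hi[OF g] unfolding sgn_diff_eq_iff max_def min_def by (smt (verit))
  qed
  have "p $ j \<le> y $ j \<and> y $ j \<le> q $ j" for j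
  proof -
    have "p $ j \<le> x $ j" "x $ j \<le> q $ j"
      using C pq by (auto simp: mem_box_cart)
    moreover have "p $ j \<in> grid_coords S j" "q $ j \<in> grid_coords S j"
      using grid_coords_of_box C pq by auto
    ultimately show ?thesis
      using same_cell[of "p $ j" j] same_cell[of "q $ j" j]
      unfolding sgn_diff_eq_iff by (smt (verit))
  qed
  then show "y \<in> \<Union>S"
    using C pq by (auto simp: mem_box_cart)
qed

section \<open>Control-affine boxes over the faces\<close>

lemma affine_box_le_if_nondegenerate:
  assumes "nondegenerate_box (affine_box a_lo c_lo a_hi c_hi u)"
  shows "(\<chi> j. a_lo j \<bullet> u + c_lo j) \<le> (\<chi> j. a_hi j \<bullet> u + c_hi j)"
proof -
  have "affine_box a_lo c_lo a_hi c_hi u \<noteq> {}"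
    using assms unfolding nondegenerate_box_def by force
  then show ?thesis
    by (simp add: affine_box_def interval_ne_empty_cart less_eq_vec_def)
qed

lemma sgn_eq_on_face:
  assumes "arrangement_face A F" and "u \<in> F" and "v \<in> F" and "(\<alpha>, \<beta>) \<in> A"
  shows "sgn (\<alpha> \<bullet> u - \<beta>) = sgn (\<alpha> \<bullet> v - \<beta>)"
proof -
  have "sign_pattern A u (\<alpha>, \<beta>) = sign_pattern A v (\<alpha>, \<beta>)"
    using assms unfolding arrangement_face_def connected_same_sign_def by metis
  then show ?thesis
    using assms(4) by (simp add: sign_pattern_def)
qed

lemma affine_box_covered_on_face:
  fixes S :: "(real ^ 'n) set set" and u_lo u_hi u v :: "real ^ 'm"
  assumes "\<forall>C\<in>S. is_box C"
    and face: "arrangement_face (enclosure_arrangement a_lo c_lo a_hi c_hi S u_lo u_hi) F"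
    and uv: "u \<in> F" "v \<in> F"
    and "nondegenerate_box (affine_box a_lo c_lo a_hi c_hi u)"
    and "affine_box a_lo c_lo a_hi c_hi u \<subseteq> \<Union>S"
  shows "affine_box a_lo c_lo a_hi c_hi v \<subseteq> \<Union>S"
  unfolding affine_box_def
proof (rule covered_if_endpoints_compare_alike)
  show "\<forall>C\<in>S. is_box C" by fact
  show "cbox (\<chi> j. a_lo j \<bullet> u + c_lo j) (\<chi> j. a_hi j \<bullet> u + c_hi j) \<subseteq> \<Union>S"
    using assms(6) by (simp add: affine_box_def)
  show "(\<chi> j. a_lo j \<bullet> u + c_lo j) \<le> (\<chi> j. a_hi j \<bullet> u + c_hi j)"
    using assms(5) by (rule affine_box_le_if_nondegenerate)
next
  fix j g assume g: "g \<in> grid_coords S j"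
  have "sgn (a_lo j \<bullet> u - (g - c_lo j)) = sgn (a_lo j \<bullet> v - (g - c_lo j))"
  proof (cases "a_lo j = 0")
    case False
    with g show ?thesis
      by (intro sgn_eq_on_face[OF face uv]) (auto simp: enclosure_arrangement_def)
  qed simp
  then show "sgn ((\<chi> j. a_lo j \<bullet> u + c_lo j) $ j - g) = sgn ((\<chi> j. a_lo j \<bullet> v + c_lo j) $ j - g)"
    by (simp add: algebra_simps)
  have "sgn (a_hi j \<bullet> u - (g - c_hi j)) = sgn (a_hi j \<bullet> v - (g - c_hi j))"
  proof (cases "a_hi j = 0")
    case False
    with g show ?thesis
      by (intro sgn_eq_on_face[OF face uv]) (auto simp: enclosure_arrangement_def)
  qed simp
  then show "sgn ((\<chi> j. a_hi j \<bullet> u + c_hi j) $ j - g) = sgn ((\<chi> j. a_hi j \<bullet> v + c_hi j) $ j - g)"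
    by (simp add: algebra_simps)
qed

lemma affine_box_subset_closed_on_closure:
  fixes T :: "(real ^ 'n) set" and R :: "(real ^ 'm) set"
  assumes "closed T"
    and covered: "\<And>u. u \<in> R \<Longrightarrow> affine_box a_lo c_lo a_hi c_hi u \<subseteq> T"
    and nondeg: "\<And>u. u \<in> R \<Longrightarrow> nondegenerate_box (affine_box a_lo c_lo a_hi c_hi u)"
    and v: "v \<in> closure R"
  shows "affine_box a_lo c_lo a_hi c_hi v \<subseteq> T"
proof
  let ?l = "\<lambda>u. \<chi> j. a_lo j \<bullet> u + c_lo j" and ?h = "\<lambda>u. \<chi> j. a_hi j \<bullet> u + c_hi j"
  fix y assume y: "y \<in> affine_box a_lo c_lo a_hi c_hi v"
  let ?k = "\<lambda>u. clamp_box (?l u) (?h u) y"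
  have "continuous_on (closure R) ?k"
    by (intro continuous_intros)
  moreover have "?k u \<in> T" if "u \<in> R" for u
  proof -
    have "?k u \<in> affine_box a_lo c_lo a_hi c_hi u"
      unfolding affine_box_def
      by (intro clamp_box_in_cbox affine_box_le_if_nondegenerate nondeg that)
    then show ?thesis
      using covered[OF that] by blast
  qed
  ultimately have "?k ` closure R \<subseteq> T"
    using \<open>closed T\<close> by (intro image_closure_subset) auto
  moreover have "?k v = y"
    using y by (intro clamp_box_id) (simp add: affine_box_def)
  ultimately show "y \<in> T"
    using imageI[OF v, of ?k] by auto
qed

theorem proposition2:
  fixes X :: "(real ^ 'n) set"
    and u_lo u_hi :: "real ^ 'm"
    and U :: "(real ^ 'm) set"
    and S :: "(real ^ 'n) set set"
    and B :: "(real ^ 'n) set"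
    and f0 :: "(real ^ 'n) \<times> (real ^ 'm) \<Rightarrow> real ^ 'n"
    and f_NN f :: "real ^ 'n \<Rightarrow> real ^ 'm \<Rightarrow> real ^ 'n"
    and \<sigma> :: "real \<Rightarrow> real"
    and D :: "((real ^ 'n) \<times> (real ^ 'm)) set"
    and a_lo a_hi :: "'n \<Rightarrow> real ^ 'm"
    and c_lo c_hi :: "'n \<Rightarrow> real"
    and enc :: "real ^ 'm \<Rightarrow> (real ^ 'n) set"
    and \<A> :: "((real ^ 'm) \<times> real) set"
    and \<F> \<R> :: "(real ^ 'm) set set"
    and \<phi> :: "real ^ 'm \<Rightarrow> nat"
  assumes "is_box X"
    and "u_lo \<le> u_hi" and "U = cbox u_lo u_hi"
    and "open D" and "X \<times> U \<subseteq> D" and "C2_bounded_partials_on f0 D"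
    and "feed_forward_network \<sigma> f_NN"
    and "\<forall>x u. f x u = f0 (x, u) + f_NN x u"
    and "subpaving X S" and "B \<in> S"
    and "control_affine_enclosure f B U a_lo c_lo a_hi c_hi"
    and "enc = affine_box a_lo c_lo a_hi c_hi"
    and "\<forall>u\<in>U. nondegenerate_box (enc u)"
    and "\<A> = enclosure_arrangement a_lo c_lo a_hi c_hi S u_lo u_hi"
    and "\<F> = {F. arrangement_face \<A> F \<and> F \<subseteq> U}"
    and "\<R> = {R \<in> \<F>. arrangement_region \<A> R}"
    and "\<phi> = covering_indicator enc S"
  shows "(\<forall>F\<in>\<F>. \<forall>u\<in>F. \<forall>v\<in>F. \<phi> u = \<phi> v) \<and>
    (\<forall>R\<in>\<R>. (\<forall>u\<in>R. \<phi> u = 1) \<longrightarrow>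
       (\<forall>F. arrangement_face \<A> F \<and> F \<subseteq> closure R \<longrightarrow> (\<forall>u\<in>F. \<phi> u = 1)))"
proof (intro conjI ballI impI allI)
  have boxes: "\<forall>C\<in>S. is_box C"
    using \<open>subpaving X S\<close> by (simp add: subpaving_def)
  fix F u v assume "F \<in> \<F>" and uv: "u \<in> F" "v \<in> F"
  then have face: "arrangement_face \<A> F" and "u \<in> U" "v \<in> U"
    using assms(15) by auto
  then have "nondegenerate_box (enc u)" "nondegenerate_box (enc v)"
    using assms(13) by auto
  then have "enc u \<subseteq> \<Union>S \<longleftrightarrow> enc v \<subseteq> \<Union>S"
    using affine_box_covered_on_face[OF boxes face[unfolded assms(14)]] uv
    unfolding assms(12) by blast
  then show "\<phi> u = \<phi> v"
    by (simp add: assms(17) covering_indicator_def)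
next
  fix R F v
  assume "R \<in> \<R>" and one: "\<forall>u\<in>R. \<phi> u = 1"
    and "arrangement_face \<A> F \<and> F \<subseteq> closure R" and "v \<in> F"
  then have "R \<subseteq> U" and v: "v \<in> closure R"
    using assms(15,16) by auto
  have "enc v \<subseteq> \<Union>S"
    unfolding assms(12)
  proof (rule affine_box_subset_closed_on_closure[OF _ _ _ v])
    show "closed (\<Union>S)"
      using \<open>subpaving X S\<close> by (rule closed_Union_subpaving)
    fix u assume "u \<in> R"
    then have "covering_indicator enc S u = 1"
      using one assms(17) by blast
    then show "affine_box a_lo c_lo a_hi c_hi u \<subseteq> \<Union>S"
      unfolding covering_indicator_def assms(12) by (metis zero_neq_one)
    show "nondegenerate_box (affine_box a_lo c_lo a_hi c_hi u)"
      using \<open>u \<in> R\<close> \<open>R \<subseteq> U\<close> assms(12,13) by auto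
  qed
  then show "\<phi> v = 1"
    by (simp add: assms(17) covering_indicator_def)
qed

end
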